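(* Let $X$ be a zero-dimensional Hausdorff space and let $A_c(X)$ be a ring with $C_c^*(X)\subseteq A_c(X)\subseteq C_c(X)$. Then a (proper) ideal $I$ in $A_c(X)$ is a $z^0$-ideal in $A_c(X)$ if and only if there exists an ideal $\mathcal P$ of closed sets in $X$ such that $I=C_{\mathcal P}(X)\cap A_c(X)$.
   Context: A space is zero-dimensional if its clopen sets form a base for its topology. $C(X)$ is the ring of real-valued continuous functions on $X$, $Z(f)=\{x\in X: f(x)=0\}$; $C_c(X)$ is the subring of those $f\in C(X)$ with countable range, and $C_c^*(X)$ is the subring of bounded members of $C_c(X)$. A family $\mathcal P$ of closed sets in $X$ is an ideal of closed sets if it is closed under finite unions and every closed subset of a member of $\mathcal P$ belongs to $\mathcal P$; $C_{\mathcal P}(X)=\{f\in C(X): \mathrm{cl}_X(X\setminus Z(f))\in\mathcal P\}$. For a commutative reduced ring $R$ with unity and $a\in R$, let $\mathcal P_a$ be the intersection of all minimal prime ideals of $R$ containing $a$ (an empty intersection being $R$); a proper ideal $I$ of $R$ is a $z^0$-ideal if $\mathcal P_a\subseteq I$ for every $a\in I$. *)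

theory Defs
  imports "HOL-Analysis.Analysis" "HOL-Algebra.Ideal" "HOL-Algebra.Subrings"
begin

definition zero_dimensional_space :: "'a topology \<Rightarrow> bool" where
  "zero_dimensional_space X \<longleftrightarrow>
     openin X = arbitrary union_of (\<lambda>U. openin X U \<and> closedin X U)"


text \<open>
  A function on \<open>topspace X\<close> is represented by its extension with the value
  \<open>undefined\<close> outside \<open>topspace X\<close>, so that equality in the carrier
  is equality of functions on the space.
\<close>

definition cont_ring :: "'a topology \<Rightarrow> ('a \<Rightarrow> real) ring" where
  "cont_ring X = \<lparr>
     carrier = {f \<in> extensional (topspace X). continuous_map X euclideanreal f},
     mult = (\<lambda>f g. \<lambda>x\<in>topspace X. f x * g x),
     one = (\<lambda>x\<in>topspace X. 1),
     zero = (\<lambda>x\<in>topspace X. 0),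
     add = (\<lambda>f g. \<lambda>x\<in>topspace X. f x + g x)\<rparr>"

definition cont_countable :: "'a topology \<Rightarrow> ('a \<Rightarrow> real) set" where
  "cont_countable X = {f \<in> carrier (cont_ring X). countable (f ` topspace X)}"

definition cont_countable_bounded :: "'a topology \<Rightarrow> ('a \<Rightarrow> real) set" where
  "cont_countable_bounded X = {f \<in> cont_countable X. bounded (f ` topspace X)}"

definition zero_set :: "'a topology \<Rightarrow> ('a \<Rightarrow> real) \<Rightarrow> 'a set" where
  "zero_set X f = {x \<in> topspace X. f x = 0}"


text \<open>
  Finite unions include the empty one, so an ideal of closed sets contains the empty set.
\<close>

definition closed_set_ideal :: "'a topology \<Rightarrow> 'a set set \<Rightarrow> bool" where
  "closed_set_ideal X \<P> \<longleftrightarrow>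
     (\<forall>S\<in>\<P>. closedin X S) \<and>
     (\<forall>\<F>. finite \<F> \<and> \<F> \<subseteq> \<P> \<longrightarrow> \<Union>\<F> \<in> \<P>) \<and>
     (\<forall>S\<in>\<P>. \<forall>T. closedin X T \<and> T \<subseteq> S \<longrightarrow> T \<in> \<P>)"

definition cont_supported :: "'a topology \<Rightarrow> 'a set set \<Rightarrow> ('a \<Rightarrow> real) set" where
  "cont_supported X \<P> =
     {f \<in> carrier (cont_ring X). X closure_of (topspace X - zero_set X f) \<in> \<P>}"


definition minimal_primeideal :: "'a set \<Rightarrow> ('a, 'b) ring_scheme \<Rightarrow> bool" where
  "minimal_primeideal P R \<longleftrightarrow>
     primeideal P R \<and> (\<forall>Q. primeideal Q R \<and> Q \<subseteq> P \<longrightarrow> Q = P)"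

text \<open>
  Intersecting with the carrier only matters when no minimal prime ideal contains \<open>a\<close>:
  the intersection is then the whole ring.
\<close>

definition min_prime_inter :: "('a, 'b) ring_scheme \<Rightarrow> 'a \<Rightarrow> 'a set" where
  "min_prime_inter R a = carrier R \<inter> \<Inter>{P. minimal_primeideal P R \<and> a \<in> P}"

definition z0_ideal :: "'a set \<Rightarrow> ('a, 'b) ring_scheme \<Rightarrow> bool" where
  "z0_ideal I R \<longleftrightarrow>
     ideal I R \<and> I \<noteq> carrier R \<and> (\<forall>a\<in>I. min_prime_inter R a \<subseteq> I)"


lemma continuous_map_restrict_topspace:
  "continuous_map X Y (restrict f (topspace X)) \<longleftrightarrow> continuous_map X Y f"
  by (metis (no_types, lifting) continuous_map_eq restrict_apply')

lemma cring_cont_ring: "cring (cont_ring X)"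
proof (rule cringI)
  show "abelian_group (cont_ring X)"
  proof (rule abelian_groupI)
    fix f assume f: "f \<in> carrier (cont_ring X)"
    let ?g = "\<lambda>x\<in>topspace X. - f x"
    have "continuous_map X euclideanreal ?g"
      using f by (auto simp: cont_ring_def continuous_map_restrict_topspace continuous_map_minus)
    then have "?g \<in> carrier (cont_ring X)" "?g \<oplus>\<^bsub>cont_ring X\<^esub> f = \<zero>\<^bsub>cont_ring X\<^esub>"
      by (auto simp: cont_ring_def)
    then show "\<exists>g\<in>carrier (cont_ring X). g \<oplus>\<^bsub>cont_ring X\<^esub> f = \<zero>\<^bsub>cont_ring X\<^esub>"
      by blast
  qed (auto simp: cont_ring_def continuous_map_add fun_eq_iff restrict_def extensional_def
         continuous_map_restrict_topspace[unfolded restrict_def])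
  show "Group.comm_monoid (cont_ring X)"
    by (rule comm_monoidI)
      (auto simp: cont_ring_def continuous_map_real_mult fun_eq_iff restrict_def extensional_def
         continuous_map_restrict_topspace[unfolded restrict_def])
qed (auto simp: cont_ring_def fun_eq_iff restrict_def algebra_simps)

lemma reduced_cont_ring:
  assumes "f \<in> carrier (cont_ring X)" "f [^]\<^bsub>cont_ring X\<^esub> (n::nat) = \<zero>\<^bsub>cont_ring X\<^esub>"
  shows "f = \<zero>\<^bsub>cont_ring X\<^esub>"
proof -
  have "(f [^]\<^bsub>cont_ring X\<^esub> n) x = f x ^ n" if "x \<in> topspace X" for x
    using that by (induction n) (auto simp: cont_ring_def nat_pow_def)
  then have "f x = 0" if "x \<in> topspace X" for x
    using that assms(2) by (force simp: cont_ring_def)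
  then show ?thesis
    using assms(1) by (auto simp: cont_ring_def extensional_def fun_eq_iff)
qed

end

theory Submission
  imports Defs
begin

text \<open>
  In a reduced ring the intersection of the minimal primes containing \<open>a\<close> is the set
  of all \<open>b\<close> annihilated by every annihilator of \<open>a\<close>. In a ring of functions that
  contains the indicators of all clopen sets of a zero-dimensional space, this condition says that
  the support of \<open>b\<close> is contained in the support of \<open>a\<close>. So a \<open>z\<^sup>0\<close>-ideal is an
  ideal determined by supports; the supports of its members generate the required ideal of closed
  sets because the support of \<open>f\<^sup>2 + g\<^sup>2\<close> is the union of those of \<open>f\<close> and \<open>g\<close>.
\<close>

section \<open>Minimal prime ideals and annihilators in reduced commutative rings\<close>

locale reduced_cring = cring +
  assumes reduced: "x \<in> carrier R \<Longrightarrow> x [^] (n::nat) = \<zero> \<Longrightarrow> x = \<zero>"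
begin

text \<open>For positive \<open>n\<close> the power \<open>(a \<otimes> t) [^] n\<close> has the
  factor \<open>a [^] n \<otimes> t\<close>, so it vanishes, and reducedness then kills its
  base.\<close>

lemma pow_mult_eq_zero:
  assumes "a \<in> carrier R" "t \<in> carrier R" "a [^] (n::nat) \<otimes> t = \<zero>"
  shows "a \<otimes> t = \<zero>"
proof (cases n)
  case 0
  then show ?thesis
    using assms by simp
next
  case (Suc m)
  have "(a \<otimes> t) [^] n = a [^] n \<otimes> (t \<otimes> t [^] m)"
    using assms(1,2) Suc by (simp add: nat_pow_distrib m_ac)
  also have "\<dots> = (a [^] n \<otimes> t) \<otimes> t [^] m"
    using assms(1,2) by (simp add: m_assoc)
  also have "\<dots> = \<zero>"
    using assms(2,3) by simp
  finally have "(a \<otimes> t) [^] n = \<zero>" .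
  then show ?thesis
    using assms reduced by blast
qed

text \<open>This set is the multiplicative submonoid generated by \<open>T\<close> and
  \<open>a\<close>. It serves to enlarge submonoids that avoid zero and, for
  \<open>T = {\<one>}\<close>, to form the powers of \<open>a\<close>.\<close>

lemma submonoid_adjoin:
  assumes "submonoid T R" "a \<in> carrier R"
  shows "submonoid {a [^] (n::nat) \<otimes> t | n t. t \<in> T} R"
    and "T \<subseteq> {a [^] (n::nat) \<otimes> t | n t. t \<in> T}"
    and "a \<in> {a [^] (n::nat) \<otimes> t | n t. t \<in> T}"
proof -
  interpret T: submonoid T R by fact
  let ?U = "{a [^] (n::nat) \<otimes> t | n t. t \<in> T}"
  show sub: "T \<subseteq> ?U"
  proof
    fix t assume "t \<in> T"
    then have "t = a [^] (0::nat) \<otimes> t" by (auto dest: T.mem_carrier)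
    with \<open>t \<in> T\<close> show "t \<in> ?U" by blast
  qed
  have "a = a [^] (1::nat) \<otimes> \<one>" using assms(2) by simp
  then show "a \<in> ?U" using T.one_closed by blast
  show "submonoid ?U R"
  proof
    show "?U \<subseteq> carrier R" using assms(2) by (auto dest: T.mem_carrier)
    show "\<one> \<in> ?U" using sub T.one_closed by blast
    fix x y assume "x \<in> ?U" "y \<in> ?U"
    then obtain m n :: nat and s t where st: "s \<in> T" "t \<in> T"
      and x: "x = a [^] m \<otimes> s" and y: "y = a [^] n \<otimes> t" by blast
    have "x \<otimes> y = a [^] (m + n) \<otimes> (s \<otimes> t)"
      using st assms(2) by (simp add: x y T.mem_carrier nat_pow_mult[symmetric] m_ac)
    then show "x \<otimes> y \<in> ?U" using st T.m_closed by blast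
  qed
qed

text \<open>Zorn's lemma is applied to submonoids rather than to primes: it enlarges
  \<open>S\<close> to a submonoid \<open>T\<close> that is maximal among those avoiding zero, and
  the complement of such a \<open>T\<close> is a minimal prime.\<close>

lemma exists_minimal_primeideal_disjoint:
  assumes "submonoid S R" "\<zero> \<notin> S"
  obtains P where "minimal_primeideal P R" "P \<inter> S = {}"
proof -
  let ?M = "{T. submonoid T R \<and> \<zero> \<notin> T \<and> S \<subseteq> T}"
  have "\<exists>T\<in>?M. \<forall>U\<in>?M. T \<subseteq> U \<longrightarrow> U = T"
  proof (rule subset_Zorn_nonempty)
    show "?M \<noteq> {}" using assms by blast
    fix C assume C: "C \<noteq> {}" "subset.chain ?M C"
    then have M: "C \<subseteq> ?M" by (auto simp: subset.chain_def)
    have "submonoid (\<Union>C) R"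
    proof
      show "\<Union>C \<subseteq> carrier R" using M by (auto dest: submonoid.mem_carrier)
      show "\<one> \<in> \<Union>C" using M C(1) by (auto dest: submonoid.one_closed)
      fix x y assume "x \<in> \<Union>C" "y \<in> \<Union>C"
      \<comment> \<open>Two elements of the union of a chain already lie in one common member, which
        is closed under products.\<close>
      then obtain T U where TU: "T \<in> C" "x \<in> T" "U \<in> C" "y \<in> U" by blast
      then have "T \<subseteq> U \<or> U \<subseteq> T" using C(2) by (auto simp: subset.chain_def)
      then obtain V where "V \<in> C" "x \<in> V" "y \<in> V" using TU by blast
      then have "x \<otimes> y \<in> V" using M submonoid.m_closed[of V R x y] by auto
      then show "x \<otimes> y \<in> \<Union>C" using \<open>V \<in> C\<close> by blast
    qed
    moreover have "\<zero> \<notin> \<Union>C" "S \<subseteq> \<Union>C" using M C(1) by auto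
    ultimately show "\<Union>C \<in> ?M" by simp
  qed
  then obtain T where "T \<in> ?M" and maxM: "\<forall>U\<in>?M. T \<subseteq> U \<longrightarrow> U = T" by (rule bexE)
  then have T: "submonoid T R" "\<zero> \<notin> T" "S \<subseteq> T" by simp_all
  have max: "U = T" if "submonoid U R" "\<zero> \<notin> U" "T \<subseteq> U" for U
    using maxM that T(3) by simp
  interpret T: submonoid T R by fact
  let ?P = "carrier R - T"
  \<comment> \<open>By maximality, adjoining an outside element \<open>a\<close> to \<open>T\<close>
    must produce zero, so some \<open>a [^] n \<otimes> t\<close> vanishes; reducedness brings the
    exponent down to one.\<close>
  have annih: "\<exists>t\<in>T. a \<otimes> t = \<zero>" if a: "a \<in> ?P" for a
  proof (rule ccontr)
    assume "\<not> ?thesis"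
    moreover have "a \<otimes> t = \<zero>" if "t \<in> T" "\<zero> = a [^] n \<otimes> t" for t and n :: nat
      using that a pow_mult_eq_zero[of a t n] T.mem_carrier by simp
    ultimately have "\<zero> \<notin> {a [^] (n::nat) \<otimes> t | n t. t \<in> T}" by blast
    moreover have ac: "a \<in> carrier R" using a by blast
    ultimately have "{a [^] (n::nat) \<otimes> t | n t. t \<in> T} = T"
      using submonoid_adjoin[OF T(1) ac] by (intro max)
    then show False
      using submonoid_adjoin(3)[OF T(1) ac] a by simp
  qed
  have notin: "a \<in> ?P" if "a \<in> carrier R" "t \<in> T" "a \<otimes> t = \<zero>" for a t
    using that T(2) T.m_closed[of a t] by auto
  have absorb: "r \<otimes> a \<in> ?P" if "a \<in> ?P" "r \<in> carrier R" for a r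
  proof -
    obtain t where "t \<in> T" "a \<otimes> t = \<zero>" using annih \<open>a \<in> ?P\<close> by blast
    then show ?thesis using that by (intro notin[of _ t]) (simp_all add: m_assoc T.mem_carrier)
  qed
  have "ideal ?P R"
  proof (rule idealI)
    show "ring R" by (rule ring_axioms)
    show "subgroup ?P (add_monoid R)"
    proof (rule add.subgroupI)
      show "?P \<subseteq> carrier R" by blast
      show "?P \<noteq> {}" using T(2) by blast
      fix a assume a: "a \<in> ?P"
      then have "\<ominus> a = (\<ominus> \<one>) \<otimes> a" by (simp add: l_minus)
      then show "\<ominus> a \<in> ?P" using absorb a by simp
      fix b assume b: "b \<in> ?P"
      obtain s t where st: "s \<in> T" "a \<otimes> s = \<zero>" "t \<in> T" "b \<otimes> t = \<zero>"
        using annih a b by blast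
      then have c: "s \<in> carrier R" "t \<in> carrier R" "a \<in> carrier R" "b \<in> carrier R"
        using a b T.mem_carrier by auto
      \<comment> \<open>The product of an annihilator of \<open>a\<close> and one of
        \<open>b\<close> annihilates the sum and stays in \<open>T\<close>.\<close>
      have "(a \<oplus> b) \<otimes> (s \<otimes> t) = (a \<otimes> s) \<otimes> t \<oplus> s \<otimes> (b \<otimes> t)"
        by (simp only: l_distr c m_closed) (simp add: c m_ac)
      then show "a \<oplus> b \<in> ?P"
        using st c T.m_closed by (intro notin[of _ "s \<otimes> t"]) simp_all
    qed
    fix a r assume "a \<in> ?P" "r \<in> carrier R"
    then show "r \<otimes> a \<in> ?P" "a \<otimes> r \<in> ?P"
      using absorb m_comm[of a r] by auto
  qed
  moreover have "\<one> \<notin> ?P" by simp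
  then have "carrier R \<noteq> ?P" by blast
  ultimately have "primeideal ?P R"
    using is_cring by (intro primeidealI) auto
  \<comment> \<open>Each \<open>a\<close> in \<open>?P\<close> has a \<open>t\<close> in
    \<open>T\<close> with product zero. Zero lies in \<open>Q\<close> while \<open>t\<close> does
    not, so primeness puts \<open>a\<close> in \<open>Q\<close>.\<close>
  moreover have "Q = ?P" if Q: "primeideal Q R" "Q \<subseteq> ?P" for Q
  proof -
    interpret Q: primeideal Q R by fact
    have "a \<in> Q" if a: "a \<in> ?P" for a
    proof -
      obtain t where t: "t \<in> T" "a \<otimes> t = \<zero>" using annih a by blast
      then have "a \<otimes> t \<in> Q" by simp
      then have "a \<in> Q \<or> t \<in> Q"
        using Q.I_prime[of a t] t(1) a T.mem_carrier by simp
      then show ?thesis using t(1) Q(2) by blast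
    qed
    then show ?thesis using Q(2) by blast
  qed
  ultimately have "minimal_primeideal ?P R" unfolding minimal_primeideal_def by blast
  then show ?thesis using that T(3) by blast
qed

text \<open>If no element outside \<open>P\<close> annihilated \<open>a\<close>, adjoining
  \<open>a\<close> to the complement of \<open>P\<close> would give a submonoid avoiding zero. A
  minimal prime disjoint from it would lie strictly inside \<open>P\<close>.\<close>

lemma minimal_primeideal_annihilator:
  assumes P: "minimal_primeideal P R" and a: "a \<in> P"
  obtains c where "c \<in> carrier R - P" "a \<otimes> c = \<zero>"
proof (rule ccontr)
  assume none: "\<not> thesis"
  interpret P: primeideal P R using P by (simp add: minimal_primeideal_def)
  have ac: "a \<in> carrier R" using a P.a_subset by blast
  have T: "submonoid (carrier R - P) R"
  proof
    show "\<one> \<in> carrier R - P" using P.one_imp_carrier P.I_notcarr by blast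
  qed (use P.I_prime in auto)
  let ?U = "{a [^] (n::nat) \<otimes> t | n t. t \<in> carrier R - P}"
  have "\<zero> \<notin> ?U"
  proof
    assume "\<zero> \<in> ?U"
    then obtain n :: nat and t where "t \<in> carrier R - P" "a [^] n \<otimes> t = \<zero>" by force
    then show False using pow_mult_eq_zero[OF ac] that none by blast
  qed
  then obtain Q where Q: "minimal_primeideal Q R" "Q \<inter> ?U = {}"
    using exists_minimal_primeideal_disjoint submonoid_adjoin(1)[OF T ac] by blast
  interpret Q: primeideal Q R using Q(1) by (simp add: minimal_primeideal_def)
  \<comment> \<open>Missing the complement of \<open>P\<close> forces
    \<open>Q \<subseteq> P\<close>; missing \<open>a\<close>, which is in \<open>P\<close>, makes
    the inclusion strict.\<close>
  have "Q \<inter> (carrier R - P) = {}" "a \<notin> Q"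
    using Q(2) submonoid_adjoin(2,3)[OF T ac] by (meson disjoint_iff subsetD)+
  moreover from this have "Q \<subseteq> P"
    using Q.a_subset by blast
  ultimately show False
    using P Q.primeideal_axioms a by (auto simp: minimal_primeideal_def)
qed

text \<open>A minimal prime containing \<open>a\<close> omits some annihilator \<open>c\<close> of
  \<open>a\<close>, so \<open>b \<otimes> c = \<zero>\<close> forces \<open>b\<close> into it.
  Conversely, a nonzero \<open>b \<otimes> c\<close> is avoided by some minimal prime, which then
  contains \<open>a\<close> but not \<open>b\<close>.\<close>

lemma min_prime_inter_eq_annihilators:
  assumes a: "a \<in> carrier R"
  shows "min_prime_inter R a =
    {b \<in> carrier R. \<forall>c\<in>carrier R. a \<otimes> c = \<zero> \<longrightarrow> b \<otimes> c = \<zero>}" (is "_ = ?B")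
proof
  show "?B \<subseteq> min_prime_inter R a"
  proof
    fix b assume b: "b \<in> ?B"
    have "b \<in> P" if P: "minimal_primeideal P R" "a \<in> P" for P
    proof -
      interpret P: primeideal P R using P by (simp add: minimal_primeideal_def)
      obtain c where c: "c \<in> carrier R - P" "a \<otimes> c = \<zero>"
        using minimal_primeideal_annihilator[OF P] .
      then have "b \<otimes> c \<in> P" using b by simp
      then show ?thesis using P.I_prime b c by blast
    qed
    then show "b \<in> min_prime_inter R a"
      using b by (simp add: min_prime_inter_def)
  qed
  show "min_prime_inter R a \<subseteq> ?B"
  proof (intro subsetI CollectI conjI ballI impI)
    fix b assume b: "b \<in> min_prime_inter R a"
    then show bc: "b \<in> carrier R" by (simp add: min_prime_inter_def)
    fix c assume c: "c \<in> carrier R" "a \<otimes> c = \<zero>"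
    show "b \<otimes> c = \<zero>"
    proof (rule ccontr)
      assume nz: "b \<otimes> c \<noteq> \<zero>"
      have one: "submonoid {\<one>} R" by standard auto
      \<comment> \<open>Adjoining to the trivial submonoid yields just the powers of
        \<open>b \<otimes> c\<close>, none of which is zero in a reduced ring.\<close>
      have "\<zero> \<notin> {(b \<otimes> c) [^] (n::nat) \<otimes> t | n t. t \<in> {\<one>}}"
      proof
        assume "\<zero> \<in> {(b \<otimes> c) [^] (n::nat) \<otimes> t | n t. t \<in> {\<one>}}"
        then obtain n :: nat where "(b \<otimes> c) [^] n = \<zero>" using bc c by auto
        then show False using reduced nz bc c by blast
      qed
      then obtain P where P: "minimal_primeideal P R" "b \<otimes> c \<notin> P"
        using exists_minimal_primeideal_disjoint submonoid_adjoin[OF one, of "b \<otimes> c"] bc c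
        by (metis (no_types, lifting) disjoint_iff m_closed)
      interpret P: primeideal P R using P by (simp add: minimal_primeideal_def)
      have "b \<notin> P" "c \<notin> P"
        using P(2) P.I_l_closed P.I_r_closed bc c by blast+
      moreover have "a \<in> P"
        using P.I_prime[of a c] a c \<open>c \<notin> P\<close> by simp
      ultimately show False
        using b P(1) by (auto simp: min_prime_inter_def)
    qed
  qed
qed

end

section \<open>Closures and clopen indicators\<close>

lemma closure_of_subset_iff:
  assumes "S \<subseteq> topspace X"
  shows "X closure_of S \<subseteq> X closure_of T \<longleftrightarrow> S \<subseteq> X closure_of T"
  using assms by (meson closedin_closure_of closure_of_minimal closure_of_subset dual_order.trans)

lemma zero_dimensional_space_clopen_nbhd:
  assumes "zero_dimensional_space X" "openin X U" "x \<in> U"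
  obtains V where "openin X V" "closedin X V" "x \<in> V" "V \<subseteq> U"
proof -
  have "(arbitrary union_of (\<lambda>U. openin X U \<and> closedin X U)) U"
    using assms(1,2) by (simp add: zero_dimensional_space_def)
  then show ?thesis
    using that assms(3) by (auto simp: union_of_def)
qed

text \<open>These functions will serve as annihilators. Every preimage is a union of some of
  \<open>V\<close> and its complement, both open, and the range has at most two values.\<close>

lemma indicator_in_cont_countable_bounded:
  assumes "openin X V" "closedin X V"
  shows "(\<lambda>x\<in>topspace X. indicator V x) \<in> cont_countable_bounded X"
proof -
  let ?f = "\<lambda>x\<in>topspace X. indicator V x :: real"
  have "openin X {x \<in> topspace X. ?f x \<in> W}" for W
  proof -
    have "{x \<in> topspace X. ?f x \<in> W} =
        (if 1 \<in> W then V else {}) \<union> (if 0 \<in> W then topspace X - V else {})"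
      using openin_subset[OF assms(1)] by (auto simp: indicator_def split: if_splits)
    then show ?thesis
      using assms by auto
  qed
  then have "continuous_map X euclideanreal ?f"
    by (auto simp: continuous_map_def)
  moreover have "finite (?f ` topspace X)"
    by (rule finite_subset[of _ "{0, 1}"]) (auto simp: indicator_def)
  ultimately show ?thesis
    by (auto simp: cont_countable_bounded_def cont_countable_def cont_ring_def
        intro: countable_finite finite_imp_bounded)
qed

section \<open>Annihilators and supports in function rings containing the clopen indicators\<close>

locale clopen_function_ring =
  fixes X :: "'a topology" and A :: "('a \<Rightarrow> real) set"
  assumes zero_dim: "zero_dimensional_space X"
    and subring: "subring A (cont_ring X)"
    and bounded_subset: "cont_countable_bounded X \<subseteq> A"
begin

abbreviation "R \<equiv> cont_ring X\<lparr>carrier := A\<rparr>"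

abbreviation "supp f \<equiv> X closure_of (topspace X - zero_set X f)"

lemma A_subset: "A \<subseteq> carrier (cont_ring X)"
  using subring by (rule subringE(1))

lemma mult_eq_zero_iff:
  "f \<otimes>\<^bsub>R\<^esub> g = \<zero>\<^bsub>R\<^esub> \<longleftrightarrow> (\<forall>x\<in>topspace X. f x = 0 \<or> g x = 0)"
  by (auto simp: cont_ring_def fun_eq_iff restrict_def)

lemma reduced_cring_R: "reduced_cring R"
proof -
  interpret C: cring "cont_ring X" by (rule cring_cont_ring)
  interpret R: cring R
    using subring C.subcringI' C.subcring_iff A_subset by blast
  show ?thesis
  proof
    fix f and n :: nat
    assume "f \<in> carrier R" "f [^]\<^bsub>R\<^esub> n = \<zero>\<^bsub>R\<^esub>"
    then show "f = \<zero>\<^bsub>R\<^esub>"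
      using reduced_cont_ring[of f X n] A_subset C.nat_pow_consistent[of f n A] by auto
  qed
qed

text \<open>Zero-dimensionality provides enough annihilators of \<open>f\<close> to detect every
  point outside its support. Conversely, a function that annihilates \<open>f\<close> vanishes on
  the whole support by continuity.\<close>

lemma annihilator_subset_iff_supp_subset:
  assumes "f \<in> A" "g \<in> A"
  shows "(\<forall>h\<in>A. f \<otimes>\<^bsub>R\<^esub> h = \<zero>\<^bsub>R\<^esub> \<longrightarrow> g \<otimes>\<^bsub>R\<^esub> h = \<zero>\<^bsub>R\<^esub>) \<longleftrightarrow> supp g \<subseteq> supp f"
proof (intro iffI ballI impI)
  assume ann: "\<forall>h\<in>A. f \<otimes>\<^bsub>R\<^esub> h = \<zero>\<^bsub>R\<^esub> \<longrightarrow> g \<otimes>\<^bsub>R\<^esub> h = \<zero>\<^bsub>R\<^esub>"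
  have "g x = 0" if x: "x \<in> topspace X" "x \<notin> supp f" for x
  proof -
    \<comment> \<open>A clopen neighbourhood \<open>V\<close> of \<open>x\<close> that misses the
      support of \<open>f\<close> has an indicator annihilating \<open>f\<close>, hence also
      \<open>g\<close>; as the indicator is 1 at \<open>x\<close>, this gives
      \<open>g x = 0\<close>.\<close>
    have "openin X (topspace X - supp f)" by (simp add: openin_diff)
    then obtain V where V: "openin X V" "closedin X V" "x \<in> V" "V \<subseteq> topspace X - supp f"
      using zero_dimensional_space_clopen_nbhd[OF zero_dim] x by blast
    let ?h = "\<lambda>x\<in>topspace X. indicator V x :: real"
    have "?h \<in> A"
      using indicator_in_cont_countable_bounded[OF V(1,2)] bounded_subset by blast
    moreover have "topspace X - zero_set X f \<subseteq> supp f"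
      by (simp add: closure_of_subset)
    then have "f \<otimes>\<^bsub>R\<^esub> ?h = \<zero>\<^bsub>R\<^esub>"
      unfolding mult_eq_zero_iff using V(4) by (auto simp: zero_set_def indicator_def)
    ultimately have "g \<otimes>\<^bsub>R\<^esub> ?h = \<zero>\<^bsub>R\<^esub>" using ann by blast
    then show ?thesis
      using V(3) x(1) unfolding mult_eq_zero_iff by auto
  qed
  then show "supp g \<subseteq> supp f"
    by (subst closure_of_subset_iff) (auto simp: zero_set_def)
next
  fix h assume sub: "supp g \<subseteq> supp f" and h: "h \<in> A" and fh: "f \<otimes>\<^bsub>R\<^esub> h = \<zero>\<^bsub>R\<^esub>"
  have cont: "continuous_map X euclideanreal h"
    using h A_subset by (auto simp: cont_ring_def)
  \<comment> \<open>Since \<open>h\<close> vanishes wherever \<open>f\<close> does not, closedness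
    of its zero set extends this to the closure.\<close>
  have "closedin X (zero_set X h)"
    using closedin_continuous_map_preimage[OF cont, of "{0}"] by (simp add: zero_set_def)
  moreover have "topspace X - zero_set X f \<subseteq> zero_set X h"
    using fh unfolding mult_eq_zero_iff by (auto simp: zero_set_def)
  ultimately have "supp f \<subseteq> zero_set X h"
    by (simp add: closure_of_minimal)
  moreover have "topspace X - zero_set X g \<subseteq> supp g"
    by (simp add: closure_of_subset)
  ultimately show "g \<otimes>\<^bsub>R\<^esub> h = \<zero>\<^bsub>R\<^esub>"
    using sub unfolding mult_eq_zero_iff zero_set_def by blast
qed

lemma min_prime_inter_eq_supp:
  assumes "f \<in> A"
  shows "min_prime_inter R f = {g \<in> A. supp g \<subseteq> supp f}"
  using reduced_cring.min_prime_inter_eq_annihilators[OF reduced_cring_R, of f]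
    annihilator_subset_iff_supp_subset assms by auto

section \<open>From ideals of functions to ideals of closed sets\<close>

lemma closed_set_ideal_supports:
  assumes I: "ideal I R"
  shows "closed_set_ideal X {S. closedin X S \<and> (\<exists>f\<in>I. S \<subseteq> supp f)}" (is "closed_set_ideal X ?P")
proof -
  interpret I: ideal I R by fact
  have Un: "\<exists>h\<in>I. supp f \<union> supp g \<subseteq> supp h" if fg: "f \<in> I" "g \<in> I" for f g
  proof -
    \<comment> \<open>Over the reals a sum of two squares vanishes only where both terms do, so no
      cancellation can shrink the support.\<close>
    let ?h = "f \<otimes>\<^bsub>R\<^esub> f \<oplus>\<^bsub>R\<^esub> g \<otimes>\<^bsub>R\<^esub> g"
    have "f \<in> carrier R" "g \<in> carrier R" using fg I.a_subset by blast+
    then have "f \<otimes>\<^bsub>R\<^esub> f \<in> I" "g \<otimes>\<^bsub>R\<^esub> g \<in> I" using fg I.I_l_closed by blast+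
    then have "?h \<in> I" by (rule additive_subgroup.a_closed[OF I.is_additive_subgroup])
    moreover have "topspace X - zero_set X ?h = (topspace X - zero_set X f) \<union> (topspace X - zero_set X g)"
      by (auto simp: zero_set_def cont_ring_def)
    then have "supp ?h = supp f \<union> supp g" by (simp add: closure_of_Un)
    ultimately show ?thesis by blast
  qed
  have "\<Union>\<F> \<in> ?P" if "finite \<F>" "\<F> \<subseteq> ?P" for \<F>
    using that
  proof (induction \<F>)
    case empty
    then show ?case
      \<comment> \<open>The empty union only requires \<open>I\<close> to have a member; zero is
        one.\<close>
      using additive_subgroup.zero_closed[OF I.is_additive_subgroup] by auto
  next
    case (insert S \<F>)
    then obtain f g where "f \<in> I" "S \<subseteq> supp f" "g \<in> I" "\<Union>\<F> \<subseteq> supp g" by auto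
    then obtain h where "h \<in> I" "S \<union> \<Union>\<F> \<subseteq> supp h" using Un[of f g] by blast
    then show ?case using insert by auto
  qed
  then show ?thesis unfolding closed_set_ideal_def by blast
qed

text \<open>In terms of supports, the condition says that \<open>I\<close> absorbs every
  \<open>g\<close> in \<open>A\<close> whose support lies in that of a member. The closed subsets of
  supports of members then recover \<open>I\<close>; conversely, any such \<P> passes its closure
  under closed subsets on to \<open>I\<close>.\<close>

lemma z0_ideal_iff_supports:
  assumes I: "ideal I R" "I \<noteq> A"
  shows "z0_ideal I R \<longleftrightarrow> (\<exists>\<P>. closed_set_ideal X \<P> \<and> I = cont_supported X \<P> \<inter> A)"
proof -
  have IA: "I \<subseteq> A"
    using additive_subgroup.a_subset[OF ideal.axioms(1)[OF I(1)]] by simp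
  have z0: "z0_ideal I R \<longleftrightarrow> (\<forall>f\<in>I. \<forall>g\<in>A. supp g \<subseteq> supp f \<longrightarrow> g \<in> I)"
  proof -
    have "(\<forall>f\<in>I. min_prime_inter R f \<subseteq> I) \<longleftrightarrow> (\<forall>f\<in>I. {g \<in> A. supp g \<subseteq> supp f} \<subseteq> I)"
      using IA by (intro ball_cong) (simp_all only: min_prime_inter_eq_supp subsetD)
    then show ?thesis
      using I by (simp add: z0_ideal_def) blast
  qed
  show ?thesis
  proof
    assume "z0_ideal I R"
    then have "I = cont_supported X {S. closedin X S \<and> (\<exists>f\<in>I. S \<subseteq> supp f)} \<inter> A"
      using z0 IA A_subset by (auto simp: cont_supported_def)
    then show "\<exists>\<P>. closed_set_ideal X \<P> \<and> I = cont_supported X \<P> \<inter> A"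
      using closed_set_ideal_supports[OF I(1)] by blast
  next
    assume "\<exists>\<P>. closed_set_ideal X \<P> \<and> I = cont_supported X \<P> \<inter> A"
    then obtain \<P> where P: "closed_set_ideal X \<P>" "I = cont_supported X \<P> \<inter> A" by blast
    have "g \<in> I" if "f \<in> I" "g \<in> A" "supp g \<subseteq> supp f" for f g
    proof -
      have "supp f \<in> \<P>" using that(1) P(2) by (simp add: cont_supported_def)
      then have "supp g \<in> \<P>"
        using P(1) that(3) unfolding closed_set_ideal_def by (meson closedin_closure_of)
      then show ?thesis using that(2) P(2) A_subset by (auto simp: cont_supported_def)
    qed
    then show "z0_ideal I R" using z0 by blast
  qed
qed

end

theorem theorem7p1:
  fixes X :: "'a topology" and A I :: "('a \<Rightarrow> real) set"
  assumes "zero_dimensional_space X"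
    and "Hausdorff_space X"
    and "subring A (cont_ring X)"
    and "cont_countable_bounded X \<subseteq> A"
    and "A \<subseteq> cont_countable X"
    and "ideal I (cont_ring X\<lparr>carrier := A\<rparr>)"
    and "I \<noteq> A"
  shows "z0_ideal I (cont_ring X\<lparr>carrier := A\<rparr>) \<longleftrightarrow>
           (\<exists>\<P>. closed_set_ideal X \<P> \<and> I = cont_supported X \<P> \<inter> A)"
proof -
  interpret clopen_function_ring X A
    by (rule clopen_function_ring.intro) fact+
  show ?thesis
    using z0_ideal_iff_supports assms by blast
qed

end
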